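(* Let $\mathbb{V}$ be an $n$-dimensional vector space with basis $e_1,\dots,e_n$, and let $O_1,\dots,O_n$ be linear operators on $\mathbb{V}$ such that the vectors $e'_i := O_i e_i$ ($i=1,\dots,n$) form another basis of $\mathbb{V}$. Let $P_1,\dots,P_n$ be the projection operators associated with the basis $(e_i)$ and $P'_1,\dots,P'_n$ those associated with the basis $(e'_i)$. Then the transformation $P_i\mapsto P'_i = O_iP_i\big(\sum_j O_jP_j\big)^{-1}$ is a similarity transformation: for every $i$, $$P'_i = \Big(\sum_{k=1}^n O_k P_k\Big) P_i \Big(\sum_{j=1}^n O_j P_j\Big)^{-1} = O_i P_i \Big(\sum_{j=1}^n O_j P_j\Big)^{-1}.$$
   Context: For a basis $(b_1,\dots,b_n)$ of a vector space, the associated projection operators $\Pi_1,\dots,\Pi_n$ are the linear operators determined by $\Pi_i b_j = \delta_{ij} b_i$; equivalently, if $v=\sum_i v_i b_i$ then $\Pi_i v = v_i b_i$. The operators $O_i$ ("separated basis transformations") are linear operators on the whole space; only the value of $O_i$ on the single basis vector $e_i$ is prescribed, by $O_ie_i=e'_i$. *)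

theory Defs
  imports Complex_Main
begin

text \<open>
  Injectivity excludes families with repetitions, whose image alone could be independent and
  spanning; it also makes the dimension exactly \<open>n\<close>.
\<close>

definition is_basis ::
    "('a::field \<Rightarrow> 'v::ab_group_add \<Rightarrow> 'v) \<Rightarrow> nat \<Rightarrow> (nat \<Rightarrow> 'v) \<Rightarrow> bool" where
  "is_basis scale n b \<longleftrightarrow>
     inj_on b {1..n} \<and>
     \<not> module.dependent scale (b ` {1..n}) \<and>
     module.span scale (b ` {1..n}) = UNIV"

text \<open>
  If \<open>v = (\<Sum>i=1..n. v\<^sub>i b\<^sub>i)\<close>, the library's \<open>representation\<close> gives the coordinate \<open>v\<^sub>i\<close>.
  The characterization of the projections by their values on the basis is
  \<open>basis_projection_unique\<close> below.
\<close>

definition basis_projection ::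
    "('a::field \<Rightarrow> 'v::ab_group_add \<Rightarrow> 'v) \<Rightarrow> nat \<Rightarrow> (nat \<Rightarrow> 'v) \<Rightarrow> nat \<Rightarrow> 'v \<Rightarrow> 'v" where
  "basis_projection scale n b i v =
     scale (module.representation scale (b ` {1..n}) v (b i)) (b i)"

definition operator_sum ::
    "nat \<Rightarrow> (nat \<Rightarrow> 'v \<Rightarrow> 'v) \<Rightarrow> 'v \<Rightarrow> 'v::ab_group_add" where
  "operator_sum n A = (\<lambda>v. \<Sum>j=1..n. A j v)"

lemma basis_projection_unique:
  fixes scale :: "'a::field \<Rightarrow> 'v::ab_group_add \<Rightarrow> 'v"
  assumes "vector_space scale" and B: "is_basis scale n b" and i: "i \<in> {1..n}"
  shows "f = basis_projection scale n b i \<longleftrightarrow>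
     Vector_Spaces.linear scale scale f \<and>
     (\<forall>j\<in>{1..n}. f (b j) = (if i = j then b i else 0))"
proof -
  interpret vector_space scale by fact
  interpret vector_space_pair scale scale ..
  let ?B = "b ` {1..n}" and ?p = "basis_projection scale n b i"
  have ind: "independent ?B" and sp: "span ?B = UNIV" and inj: "inj_on b {1..n}"
    using B by (auto simp: is_basis_def)
  have lin: "Vector_Spaces.linear scale scale ?p"
    by unfold_locales
      (simp_all add: basis_projection_def representation_add[OF ind] representation_scale[OF ind]
        sp scale_left_distrib del: One_nat_def)
  have val: "\<forall>j\<in>{1..n}. ?p (b j) = (if i = j then b i else 0)"
  proof
    fix j assume j: "j \<in> {1..n}"
    have "representation ?B (b j) (b i) = (if b i = b j then 1 else 0)"
      using representation_basis[OF ind imageI[OF j]] by auto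
    moreover have "b i = b j \<longleftrightarrow> i = j"
      using inj_onD[OF inj _ i j] by blast
    ultimately show "?p (b j) = (if i = j then b i else 0)"
      by (cases "i = j") (simp_all add: basis_projection_def del: One_nat_def)
  qed
  have "f = ?p" if lin_f: "Vector_Spaces.linear scale scale f"
    and val_f: "\<forall>j\<in>{1..n}. f (b j) = (if i = j then b i else 0)"
  proof
    fix x
    show "f x = ?p x"
    proof (rule linear_eq_on[OF lin_f lin])
      show "x \<in> span ?B"
        by (simp only: sp UNIV_I)
      show "f y = ?p y" if "y \<in> ?B" for y
        using that val_f val by (metis imageE)
    qed
  qed
  with lin val show ?thesis by blast
qed

end

theory Submission
  imports Defs
begin

text \<open>
  The operator \<open>S = (\<Sum>j. T j \<circ> P j)\<close> is the change of basis \<open>e i \<mapsto> e' i\<close>, hence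
  invertible, and conjugation by it carries the projections of \<open>e\<close> to those of \<open>e'\<close>.
  Since \<open>S\<close> agrees with \<open>T i\<close> on the line through \<open>e i\<close>, which is the range of \<open>P i\<close>, the
  left factor \<open>S\<close> of the conjugation may be replaced by \<open>T i\<close>.
\<close>

lemma linear_eq_on_basis:
  fixes scale :: "'a::field \<Rightarrow> 'v::ab_group_add \<Rightarrow> 'v"
  assumes "vector_space scale" and B: "is_basis scale n b"
    and f: "Vector_Spaces.linear scale scale f" and g: "Vector_Spaces.linear scale scale g"
    and eq: "\<And>i. i \<in> {1..n} \<Longrightarrow> f (b i) = g (b i)"
  shows "f = g"
proof
  interpret vector_space scale by fact
  interpret vector_space_pair scale scale ..
  fix x
  show "f x = g x"
  proof (rule linear_eq_on[OF f g])
    show "x \<in> span (b ` {1..n})"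
      using B by (simp add: is_basis_def)
    show "f y = g y" if "y \<in> b ` {1..n}" for y
      using that eq by blast
  qed
qed

lemma linear_extension_of_basis:
  fixes scale :: "'a::field \<Rightarrow> 'v::ab_group_add \<Rightarrow> 'v"
  assumes "vector_space scale" and B: "is_basis scale n b"
  obtains f where "Vector_Spaces.linear scale scale f" and "\<And>i. i \<in> {1..n} \<Longrightarrow> f (b i) = c i"
proof -
  interpret vector_space scale by fact
  interpret vector_space_pair scale scale ..
  have ind: "independent (b ` {1..n})" and inj: "inj_on b {1..n}"
    using B by (auto simp: is_basis_def)
  \<comment> \<open>The library extends functions on the set of basis vectors, whereas
    \<open>c\<close> is indexed by numbers. Since \<open>b\<close> is injective on the index range,
    \<open>inv_into\<close> recovers the index of each basis vector.\<close>
  obtain f where lin: "Vector_Spaces.linear scale scale f"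
    and f: "\<forall>x\<in>b ` {1..n}. f x = (c \<circ> inv_into {1..n} b) x"
    using linear_independent_extend[OF ind, of "c \<circ> inv_into {1..n} b"] by blast
  have "f (b i) = c i" if "i \<in> {1..n}" for i
    using f that inv_into_f_f[OF inj that] by auto
  with lin show thesis by (rule that)
qed

text \<open>No dimension count is needed: the linear extension \<open>R\<close> of
  \<open>c i\<close> \<mapsto> \<open>b i\<close> is a two-sided inverse, because
  \<open>S \<circ> R\<close> fixes every \<open>c i\<close>, \<open>R \<circ> S\<close> fixes every
  \<open>b i\<close>, and a linear map is determined by its values on a basis.\<close>

lemma change_of_basis_inverse:
  fixes scale :: "'a::field \<Rightarrow> 'v::ab_group_add \<Rightarrow> 'v"
  assumes V: "vector_space scale" and b: "is_basis scale n b" and c: "is_basis scale n c"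
    and S: "Vector_Spaces.linear scale scale S"
    and Sb: "\<And>i. i \<in> {1..n} \<Longrightarrow> S (b i) = c i"
  shows "bij S" and "Vector_Spaces.linear scale scale (inv S)"
    and "\<And>i. i \<in> {1..n} \<Longrightarrow> inv S (c i) = b i"
proof -
  interpret vector_space scale by fact
  obtain R where R: "Vector_Spaces.linear scale scale R"
    and Rc: "\<And>i. i \<in> {1..n} \<Longrightarrow> R (c i) = b i"
    using linear_extension_of_basis[OF V c] by blast
  have SR: "S \<circ> R = id"
    by (rule linear_eq_on_basis[OF V c Vector_Spaces.linear_compose[OF R S] linear_id])
      (simp only: o_apply id_apply Rc Sb)
  have RS: "R \<circ> S = id"
    by (rule linear_eq_on_basis[OF V b Vector_Spaces.linear_compose[OF S R] linear_id])
      (simp only: o_apply id_apply Rc Sb)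
  show "bij S"
    using RS SR by (rule o_bij)
  have "inv S = R"
    using SR RS by (rule inv_unique_comp)
  then show "Vector_Spaces.linear scale scale (inv S)"
    and "\<And>i. i \<in> {1..n} \<Longrightarrow> inv S (c i) = b i"
    using R Rc by simp_all
qed

text \<open>By \<open>basis_projection_unique\<close> it suffices to follow one vector
  \<open>c j\<close>: \<open>inv S\<close> takes it to \<open>b j\<close>, the projection keeps it
  for \<open>j = i\<close> and kills it otherwise, and \<open>S\<close> returns \<open>b i\<close>
  to \<open>c i\<close> and 0 to 0.\<close>

lemma basis_projection_conjugate:
  fixes scale :: "'a::field \<Rightarrow> 'v::ab_group_add \<Rightarrow> 'v"
  assumes V: "vector_space scale" and b: "is_basis scale n b" and c: "is_basis scale n c"
    and S: "Vector_Spaces.linear scale scale S"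
    and Sb: "\<And>i. i \<in> {1..n} \<Longrightarrow> S (b i) = c i"
    and i: "i \<in> {1..n}"
  shows "S \<circ> basis_projection scale n b i \<circ> inv S = basis_projection scale n c i"
proof (subst basis_projection_unique[OF V c i], intro conjI ballI)
  interpret vector_space scale by fact
  interpret vector_space_pair scale scale ..
  have P: "Vector_Spaces.linear scale scale (basis_projection scale n b i)"
    and Pb: "\<And>j. j \<in> {1..n} \<Longrightarrow> basis_projection scale n b i (b j) = (if i = j then b i else 0)"
    using basis_projection_unique[OF V b i, of "basis_projection scale n b i"] by auto
  show "Vector_Spaces.linear scale scale (S \<circ> basis_projection scale n b i \<circ> inv S)"
    by (rule Vector_Spaces.linear_compose[OF change_of_basis_inverse(2)[OF V b c S Sb]
          Vector_Spaces.linear_compose[OF P S]])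
  fix j assume j: "j \<in> {1..n}"
  have "inv S (c j) = b j"
    using Sb j by (rule change_of_basis_inverse(3)[OF V b c S])
  then show "(S \<circ> basis_projection scale n b i \<circ> inv S) (c j) = (if i = j then c i else 0)"
    by (simp only: o_apply Pb[OF j] if_distrib[of S] Sb[OF i] linear_0[OF S])
qed

theorem proposition2p1:
  fixes scale :: "'a::field \<Rightarrow> 'v::ab_group_add \<Rightarrow> 'v"
    and n :: nat
    and e e' :: "nat \<Rightarrow> 'v"
    and T P P' :: "nat \<Rightarrow> 'v \<Rightarrow> 'v"
    and S :: "'v \<Rightarrow> 'v"
  assumes "vector_space scale"
    and "is_basis scale n e"
    and "\<And>i. i \<in> {1..n} \<Longrightarrow> Vector_Spaces.linear scale scale (T i)"
    and "\<And>i. i \<in> {1..n} \<Longrightarrow> e' i = T i (e i)"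
    and "is_basis scale n e'"
    and "\<And>i. i \<in> {1..n} \<Longrightarrow> P i = basis_projection scale n e i"
    and "\<And>i. i \<in> {1..n} \<Longrightarrow> P' i = basis_projection scale n e' i"
    and "S = operator_sum n (\<lambda>j. T j \<circ> P j)"
  shows "Vector_Spaces.linear scale scale S \<and> bij S \<and>
    (\<forall>i\<in>{1..n}. P' i = S \<circ> P i \<circ> inv S \<and> S \<circ> P i \<circ> inv S = T i \<circ> P i \<circ> inv S)"
proof -
  note V = assms(1) and e = assms(2) and T = assms(3) and e' = assms(5)
  interpret vector_space scale by fact
  interpret vector_space_pair scale scale ..
  have P: "Vector_Spaces.linear scale scale (P i)"
    and Pe: "\<And>j. j \<in> {1..n} \<Longrightarrow> P i (e j) = (if i = j then e i else 0)"
    if "i \<in> {1..n}" for i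
    using basis_projection_unique[OF V e that, of "P i"] assms(6)[OF that] by auto
  have S_def: "S = (\<lambda>v. \<Sum>j=1..n. (T j \<circ> P j) v)"
    using assms(8) by (simp only: operator_sum_def)
  have S: "Vector_Spaces.linear scale scale S"
    unfolding S_def
    by (rule linear_compose_sum) (blast intro: Vector_Spaces.linear_compose[OF P T])
  have Se: "S (e i) = e' i" if i: "i \<in> {1..n}" for i
  proof -
    \<comment> \<open>For \<open>j\<close> other than \<open>i\<close>, \<open>P j\<close>
      annihilates \<open>e i\<close> and \<open>T j\<close> maps 0 to 0, so only the term
      \<open>T i (e i)\<close> survives.\<close>
    have "S (e i) = (\<Sum>j=1..n. if j = i then e' i else 0)"
      unfolding S_def
      by (rule sum.cong) (use i Pe assms(4) linear_0[OF T] in auto)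
    also have "\<dots> = e' i"
      using i by simp
    finally show ?thesis .
  qed
  have "S \<circ> P i = T i \<circ> P i" if i: "i \<in> {1..n}" for i
    \<comment> \<open>Unfolding the projection exhibits \<open>P i v\<close> as a multiple of
      \<open>e i\<close>; linearity pulls out the scalar, and both sides become the same multiple of
      \<open>e' i\<close>.\<close>
    by (simp add: fun_eq_iff assms(6)[OF i] basis_projection_def linear_scale[OF S]
        linear_scale[OF T[OF i]] Se[OF i] assms(4)[OF i] del: One_nat_def)
  moreover have "P' i = S \<circ> P i \<circ> inv S" if i: "i \<in> {1..n}" for i
    using basis_projection_conjugate[OF V e e' S Se i] assms(6,7)[OF i] by simp
  ultimately show ?thesis
    using S change_of_basis_inverse(1)[OF V e e' S Se] by simp
qed

end
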